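(* Let $M$ be a connected and complete Riemannian manifold without boundary, modelled on a separable Hilbert space, of class $C^{1,1}$ and with Riemannian metric of class $C^{0,1}$. Let $f\colon M\to\mathbb{R}$ be a $C^{1,1}$ function with gradient vector field $\nabla f$. Let $g\colon\mathbb{R}\to\mathbb{R}$ be a smooth monotone function with $g(x)=1$ for $x\le1$, $g(x)\le x$ for $1\le x\le2$ and $g(x)=x$ for $x\ge2$; set $h(m)=1/g(\|\nabla f(m)\|)$ for $m\in M$, and let $\{\varphi_t\}$, $t\in\mathbb{R}$, be the flow on $M$ of the bounded $C^{0,1}$ vector field $V=-h\,\nabla f$. Let $\tau>0$. If $f$ satisfies the Palais--Smale condition (C), then the pair $(f,\varphi_\tau)$ satisfies condition (D) on $M$.
   Context: A map is $C^{r,1}$, $r\ge0$, if all its derivatives up to order $r$ exist and are locally Lipschitz continuous. $\langle\cdot,\cdot\rangle_m$ and $\|\cdot\|_m$ denote the inner product and norm on $T_mM$. The gradient is defined by $Df(m)(v)=\langle\nabla f(m),v\rangle_m$ for all $v\in T_mM$; $m$ is a critical point of $f$ if $\nabla f(m)=0$. Completeness refers to the metric on $M$ given by the infimum of lengths of $C^1$ paths; it guarantees that the bounded vector field $V$ integrates to a flow defined for all $t\in\mathbb{R}$. Palais--Smale condition (C): if $A$ is a subset of $M$ on which $|f|$ is bounded but on which $\|\nabla f\|$ is not bounded away from zero, then there is a critical point of $f$ in the closure of $A$. Condition (D) for $(f,\varphi)$ on $M$, where $\varphi\colon M\to M$: $f(\varphi(x))<f(x)$ whenever $x$ is not a fixed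 point of $\varphi$, and if $A$ is a subset of $M$ on which $|f|$ is bounded but on which $f(y)-f(\varphi(y))$ is not bounded away from zero, then there is a fixed point of $\varphi$ in the closure of $A$. *)

theory Defs
  imports "HOL-Analysis.Analysis"
begin

section \<open>Maps of class \<open>C\<^sup>0\<^sup>,\<^sup>1\<close> and \<open>C\<^sup>1\<^sup>,\<^sup>1\<close>\<close>

definition locally_lipschitz_on :: "'a::metric_space set \<Rightarrow> ('a \<Rightarrow> 'b::metric_space) \<Rightarrow> bool" where
  "locally_lipschitz_on S f \<longleftrightarrow> (\<forall>x\<in>S. \<exists>u>0. \<exists>L. L-lipschitz_on (ball x u \<inter> S) f)"

text \<open>Only used for open \<open>S\<close>.\<close>
definition C11_on :: "'a::real_normed_vector set \<Rightarrow> ('a \<Rightarrow> 'b::real_normed_vector) \<Rightarrow> bool" where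
  "C11_on S f \<longleftrightarrow> locally_lipschitz_on S f \<and>
     (\<exists>f' :: 'a \<Rightarrow> 'a \<Rightarrow>\<^sub>L 'b.
        (\<forall>x\<in>S. (f has_derivative blinfun_apply (f' x)) (at x)) \<and> locally_lipschitz_on S f')"

definition smooth_real :: "(real \<Rightarrow> real) \<Rightarrow> bool" where
  "smooth_real g \<longleftrightarrow> (\<forall>n x. ((deriv ^^ n) g) field_differentiable (at x))"

section \<open>Manifolds of class \<open>C\<^sup>1\<^sup>,\<^sup>1\<close> modelled on a Hilbert space\<close>

text \<open>
  The manifold is the whole Hausdorff space \<open>'m\<close>; the model space is \<open>'e\<close>.  A chart is a
  pair of a domain and a coordinate map; the values of the coordinate map outside the domain
  are irrelevant.  Charts have open image in \<open>'e\<close>, so there is no boundary.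
\<close>

type_synonym ('m, 'e) chart = "'m set \<times> ('m \<Rightarrow> 'e)"

definition chart_inv :: "('m, 'e) chart \<Rightarrow> 'e \<Rightarrow> 'm" where
  "chart_inv c = inv_into (fst c) (snd c)"

definition C11_atlas :: "('m::t2_space, 'e::{real_inner,banach}) chart set \<Rightarrow> bool" where
  "C11_atlas \<A> \<longleftrightarrow>
     (\<Union>c\<in>\<A>. fst c) = UNIV \<and>
     (\<forall>c\<in>\<A>. open (fst c) \<and> open (snd c ` fst c) \<and>
        homeomorphism (fst c) (snd c ` fst c) (snd c) (chart_inv c)) \<and>
     (\<forall>c\<in>\<A>. \<forall>c'\<in>\<A>. C11_on (snd c ` (fst c \<inter> fst c')) (snd c' \<circ> chart_inv c))"

text \<open>
  A tangent vector at \<open>m\<close> is given by its components in all charts around \<open>m\<close>, related to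
  each other by the derivatives of the transition maps; that is, the equivalence class of pairs
  (chart, vector) is represented by its graph.  Components in charts not containing \<open>m\<close> are \<open>0\<close>,
  so that the vector is determined by its equivalence class.  The linear structure is
  componentwise, and the zero vector is \<open>\<lambda>c. 0\<close>.
\<close>

type_synonym ('m, 'e) tvec = "('m, 'e) chart \<Rightarrow> 'e"

definition tangent_space ::
    "('m::t2_space, 'e::{real_inner,banach}) chart set \<Rightarrow> 'm \<Rightarrow> ('m, 'e) tvec set" where
  "tangent_space \<A> m = {v.
     (\<forall>c\<in>\<A>. \<forall>c'\<in>\<A>. m \<in> fst c \<longrightarrow> m \<in> fst c' \<longrightarrow>
        v c' = frechet_derivative (snd c' \<circ> chart_inv c) (at (snd c m)) (v c)) \<and>
     (\<forall>c. \<not> (c \<in> \<A> \<and> m \<in> fst c) \<longrightarrow> v c = 0)}"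

section \<open>Riemannian metrics of class \<open>C\<^sup>0\<^sup>,\<^sup>1\<close>\<close>

text \<open>
  In a chart the metric is a locally Lipschitz family of symmetric bounded bilinear forms on \<open>'e\<close>.
  The constant \<open>\<alpha>\<close> says that the inner product on each tangent space induces the topology of the
  model space, i.e. makes the tangent space a Hilbert space, as required of a Riemannian metric
  on a Hilbert manifold.  Values of \<open>ip m\<close> outside the tangent space at \<open>m\<close> are irrelevant.
\<close>

definition riemannian_metric_C01 ::
    "('m::t2_space, 'e::{real_inner,banach}) chart set \<Rightarrow>
     ('m \<Rightarrow> ('m, 'e) tvec \<Rightarrow> ('m, 'e) tvec \<Rightarrow> real) \<Rightarrow> bool" where
  "riemannian_metric_C01 \<A> ip \<longleftrightarrow>
     (\<forall>c\<in>\<A>. \<exists>G :: 'e \<Rightarrow> 'e \<Rightarrow>\<^sub>L 'e \<Rightarrow>\<^sub>L real.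
        locally_lipschitz_on (snd c ` fst c) G \<and>
        (\<forall>m\<in>fst c.
           (\<forall>v\<in>tangent_space \<A> m. \<forall>w\<in>tangent_space \<A> m.
              ip m v w = blinfun_apply (blinfun_apply (G (snd c m)) (v c)) (w c)) \<and>
           (\<forall>x y. blinfun_apply (blinfun_apply (G (snd c m)) x) y =
                  blinfun_apply (blinfun_apply (G (snd c m)) y) x) \<and>
           (\<exists>\<alpha>>0. \<forall>x. \<alpha> * (norm x)\<^sup>2 \<le> blinfun_apply (blinfun_apply (G (snd c m)) x) x)))"

definition tnorm ::
    "('m \<Rightarrow> ('m, 'e) tvec \<Rightarrow> ('m, 'e) tvec \<Rightarrow> real) \<Rightarrow> 'm \<Rightarrow> ('m, 'e) tvec \<Rightarrow> real" where
  "tnorm ip m v = sqrt (ip m v v)"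

section \<open>Curves, Riemannian distance and completeness\<close>

definition has_velocity ::
    "('m::t2_space, 'e::{real_inner,banach}) chart set \<Rightarrow> (real \<Rightarrow> 'm) \<Rightarrow> real \<Rightarrow> real set \<Rightarrow>
     ('m, 'e) tvec \<Rightarrow> bool" where
  "has_velocity \<A> \<gamma> t S v \<longleftrightarrow>
     continuous (at t within S) \<gamma> \<and> v \<in> tangent_space \<A> (\<gamma> t) \<and>
     (\<forall>c\<in>\<A>. \<gamma> t \<in> fst c \<longrightarrow> ((snd c \<circ> \<gamma>) has_vector_derivative v c) (at t within S))"

definition C1_path ::
    "('m::t2_space, 'e::{real_inner,banach}) chart set \<Rightarrow> (real \<Rightarrow> 'm) \<Rightarrow>
     (real \<Rightarrow> ('m, 'e) tvec) \<Rightarrow> bool" where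
  "C1_path \<A> \<gamma> \<gamma>' \<longleftrightarrow>
     (\<forall>t\<in>{0..1}. has_velocity \<A> \<gamma> t {0..1} (\<gamma>' t)) \<and>
     (\<forall>c\<in>\<A>. continuous_on {t\<in>{0..1}. \<gamma> t \<in> fst c} (\<lambda>t. \<gamma>' t c))"

definition riemannian_dist ::
    "('m::t2_space, 'e::{real_inner,banach}) chart set \<Rightarrow>
     ('m \<Rightarrow> ('m, 'e) tvec \<Rightarrow> ('m, 'e) tvec \<Rightarrow> real) \<Rightarrow> 'm \<Rightarrow> 'm \<Rightarrow> real" where
  "riemannian_dist \<A> ip x y =
     Inf {integral {0..1} (\<lambda>t. tnorm ip (\<gamma> t) (\<gamma>' t)) | \<gamma> \<gamma>'.
            C1_path \<A> \<gamma> \<gamma>' \<and> \<gamma> 0 = x \<and> \<gamma> 1 = y}"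

definition riemannian_complete ::
    "('m::t2_space, 'e::{real_inner,banach}) chart set \<Rightarrow>
     ('m \<Rightarrow> ('m, 'e) tvec \<Rightarrow> ('m, 'e) tvec \<Rightarrow> real) \<Rightarrow> bool" where
  "riemannian_complete \<A> ip \<longleftrightarrow> Metric_space.mcomplete UNIV (riemannian_dist \<A> ip)"

section \<open>Functions, gradients and flows\<close>

definition C11_function ::
    "('m::t2_space, 'e::{real_inner,banach}) chart set \<Rightarrow> ('m \<Rightarrow> real) \<Rightarrow> bool" where
  "C11_function \<A> f \<longleftrightarrow> (\<forall>c\<in>\<A>. C11_on (snd c ` fst c) (f \<circ> chart_inv c))"

text \<open>By the chain rule, the choice of the chart \<open>c\<close> around \<open>m\<close> is immaterial for tangent vectors \<open>v\<close>.\<close>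
definition differential ::
    "('m::t2_space, 'e::{real_inner,banach}) chart set \<Rightarrow> ('m \<Rightarrow> real) \<Rightarrow> 'm \<Rightarrow>
     ('m, 'e) tvec \<Rightarrow> real" where
  "differential \<A> f m v =
     (let c = (SOME c. c \<in> \<A> \<and> m \<in> fst c)
      in frechet_derivative (f \<circ> chart_inv c) (at (snd c m)) (v c))"

definition gradient ::
    "('m::t2_space, 'e::{real_inner,banach}) chart set \<Rightarrow>
     ('m \<Rightarrow> ('m, 'e) tvec \<Rightarrow> ('m, 'e) tvec \<Rightarrow> real) \<Rightarrow> ('m \<Rightarrow> real) \<Rightarrow> 'm \<Rightarrow> ('m, 'e) tvec" where
  "gradient \<A> ip f m =
     (THE X. X \<in> tangent_space \<A> m \<and>
             (\<forall>v\<in>tangent_space \<A> m. differential \<A> f m v = ip m X v))"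

definition critical_point ::
    "('m::t2_space, 'e::{real_inner,banach}) chart set \<Rightarrow>
     ('m \<Rightarrow> ('m, 'e) tvec \<Rightarrow> ('m, 'e) tvec \<Rightarrow> real) \<Rightarrow> ('m \<Rightarrow> real) \<Rightarrow> 'm \<Rightarrow> bool" where
  "critical_point \<A> ip f m \<longleftrightarrow> gradient \<A> ip f m = (\<lambda>c. 0)"

text \<open>
  The curves \<open>t \<mapsto> \<phi> t x\<close>, defined for all real \<open>t\<close>, are the integral curves of \<open>V\<close> starting at \<open>x\<close>.
  For a locally Lipschitz vector field this determines \<open>\<phi>\<close> and implies the group law.
\<close>
definition is_flow ::
    "('m::t2_space, 'e::{real_inner,banach}) chart set \<Rightarrow> ('m \<Rightarrow> ('m, 'e) tvec) \<Rightarrow>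
     (real \<Rightarrow> 'm \<Rightarrow> 'm) \<Rightarrow> bool" where
  "is_flow \<A> V \<phi> \<longleftrightarrow>
     (\<forall>x. \<phi> 0 x = x \<and> (\<forall>t. has_velocity \<A> (\<lambda>s. \<phi> s x) t UNIV (V (\<phi> t x))))"

section \<open>Conditions (C) and (D)\<close>

definition bounded_away_from_zero_on :: "'a set \<Rightarrow> ('a \<Rightarrow> real) \<Rightarrow> bool" where
  "bounded_away_from_zero_on S u \<longleftrightarrow> (\<exists>\<epsilon>>0. \<forall>x\<in>S. \<epsilon> \<le> \<bar>u x\<bar>)"

definition condition_C ::
    "('m::t2_space, 'e::{real_inner,banach}) chart set \<Rightarrow>
     ('m \<Rightarrow> ('m, 'e) tvec \<Rightarrow> ('m, 'e) tvec \<Rightarrow> real) \<Rightarrow> ('m \<Rightarrow> real) \<Rightarrow> bool" where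
  "condition_C \<A> ip f \<longleftrightarrow>
     (\<forall>S. bounded (f ` S) \<and>
          \<not> bounded_away_from_zero_on S (\<lambda>m. tnorm ip m (gradient \<A> ip f m)) \<longrightarrow>
          (\<exists>c\<in>closure S. critical_point \<A> ip f c))"

definition condition_D :: "('m::topological_space \<Rightarrow> real) \<Rightarrow> ('m \<Rightarrow> 'm) \<Rightarrow> bool" where
  "condition_D f \<psi> \<longleftrightarrow>
     (\<forall>x. \<psi> x \<noteq> x \<longrightarrow> f (\<psi> x) < f x) \<and>
     (\<forall>S. bounded (f ` S) \<and> \<not> bounded_away_from_zero_on S (\<lambda>y. f y - f (\<psi> y)) \<longrightarrow>
          (\<exists>x\<in>closure S. \<psi> x = x))"

end

theory Submission
  imports Defs
begin

text \<open>
  Along a flow line the derivative of \<open>f\<close> is minus the descent rate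
  \<open>h \<parallel>\<nabla>f\<parallel>\<^sup>2 \<ge> 0\<close> (\<open>derivative_along_gradient_flow\<close>).  By the mean value theorem, the
  decrease \<open>f y - f (\<phi>\<^sub>\<tau> y)\<close> is \<open>\<tau>\<close> times the rate at some intermediate point \<open>\<phi>\<^sub>t y\<close>, and since
  \<open>g x \<le> max 1 x\<close>, a rate below \<open>1\<close> equals \<open>\<parallel>\<nabla>f\<parallel>\<^sup>2\<close>.  So a small decrease over time \<open>\<tau>\<close> produces
  a point with small gradient on the piece of the flow line between \<open>y\<close> and \<open>\<phi>\<^sub>\<tau> y\<close>, and no decrease
  at all produces a critical point there.

  The second ingredient is that a critical point \<open>p\<close> holds nearby flow lines back: given a
  neighbourhood \<open>W\<close> of \<open>p\<close> and a time \<open>T\<close>, a flow line that visits a sufficiently small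
  neighbourhood of \<open>p\<close> lies in \<open>W\<close> for the time \<open>T\<close> before and after that visit
  (\<open>flow_stable_near_critical_point\<close>).  In a chart around \<open>p\<close> the vector field vanishes at \<open>p\<close> and
  is bounded by a multiple of the distance to \<open>p\<close>, because \<open>0 < h \<le> 1\<close>, \<open>Df\<close> is locally Lipschitz and the
  metric is coercive, uniformly near \<open>p\<close> (\<open>gradient_linear_bound_at_critical_point\<close>).
  Gronwall's inequality then bounds how fast a flow line can leave.

  Both halves of condition (D) follow.  Taking \<open>W\<close> arbitrarily small shows that a flow line
  through a critical point is constant, hence a point at which \<open>f\<close> does not decrease is fixed by
  \<open>\<phi>\<^sub>\<tau>\<close>.  For a set \<open>S\<close> on which the decrease is not bounded away from zero, condition (C) is
  applied not to \<open>S\<close> but to the set \<open>A\<close> of intermediate points \<open>\<phi>\<^sub>t y\<close>, \<open>y \<in> S\<close>, \<open>0 \<le> t \<le> \<tau>\<close>, reached with a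
  decrease of at most \<open>1\<close>.  It gives a critical point \<open>p\<close> in the closure of \<open>A\<close>; every neighbourhood
  \<open>W\<close> of \<open>p\<close> contains the flow line pieces through points of \<open>A\<close> close enough to \<open>p\<close>, including
  their starting points in \<open>S\<close>.  So \<open>p\<close> lies in the closure of \<open>S\<close>, and \<open>\<phi>\<^sub>\<tau>\<close> fixes it.
\<close>

section \<open>Representing functionals by coercive symmetric forms\<close>

text \<open>
  The Riesz representation theorem, needed for the existence of the gradient.  The
  representing vector minimises \<open>J x = B x x - 2 l x\<close>: by the parallelogram identity
  minimising sequences are Cauchy, and at a minimum the first variation \<open>2 (B x y - l y)\<close> of \<open>J\<close>
  vanishes.
\<close>
lemma coercive_symmetric_form_represents:
  fixes B :: "'e::{real_normed_vector,banach} \<Rightarrow>\<^sub>L 'e \<Rightarrow>\<^sub>L real" and l :: "'e \<Rightarrow>\<^sub>L real"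
  assumes sym: "\<And>x y. B x y = B y x"
    and "\<alpha> > 0" and coercive: "\<And>x. \<alpha> * (norm x)\<^sup>2 \<le> B x x"
  shows "\<exists>x. \<forall>y. B x y = l y"
proof -
  define J where "J x = B x x - 2 * l x" for x
  have J_lower: "- (norm l)\<^sup>2 / \<alpha> \<le> J x" for x
  proof -
    have "l x \<le> norm l * norm x"
      using norm_blinfun[of l x] by simp
    moreover have "0 \<le> (\<alpha> * norm x - norm l)\<^sup>2 / \<alpha>"
      using \<open>\<alpha> > 0\<close> by simp
    then have "- (norm l)\<^sup>2 / \<alpha> \<le> \<alpha> * (norm x)\<^sup>2 - 2 * (norm l * norm x)"
      using \<open>\<alpha> > 0\<close> by (simp add: power2_eq_square field_simps)
    ultimately show ?thesis
      using coercive[of x] by (simp add: J_def)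
  qed
  define I where "I = Inf (range J)"
  have bdd: "bdd_below (range J)"
    using J_lower by (meson bdd_belowI2)
  have I_le: "I \<le> J x" for x
    unfolding I_def using bdd by (simp add: cINF_lower)
  have "\<exists>x. J x < I + e" if "e > 0" for e
    using cInf_lessD[of "range J" "I + e"] that by (auto simp: I_def)
  then have "\<exists>x. J x < I + inverse (real (Suc n))" for n
    by simp
  then obtain X where X: "\<And>n. J (X n) < I + inverse (real (Suc n))"
    by metis
  have parallelogram: "\<alpha> / 2 * (norm (x - y))\<^sup>2 \<le> J x + J y - 2 * I" for x y
  proof -
    have "J x + J y - 2 * J ((1/2) *\<^sub>R (x + y)) = B (x - y) (x - y) / 2"
      using sym[of x y]
      by (simp add: J_def blinfun.bilinear_simps field_simps)
    then show ?thesis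
      using I_le[of "(1/2) *\<^sub>R (x + y)"] coercive[of "x - y"] by simp
  qed
  have "Cauchy X"
  proof (rule metric_CauchyI)
    fix e :: real assume "e > 0"
    then obtain N where N: "inverse (real (Suc N)) < \<alpha> * e\<^sup>2 / 4"
      using \<open>\<alpha> > 0\<close> reals_Archimedean[of "\<alpha> * e\<^sup>2 / 4"] by auto
    have "dist (X m) (X n) < e" if "m \<ge> N" "n \<ge> N" for m n
    proof -
      have close: "J (X k) < I + inverse (real (Suc N))" if "k \<ge> N" for k
        using X[of k] le_imp_inverse_le[of "real (Suc N)" "real (Suc k)"] that by linarith
      then have "\<alpha> / 2 * (norm (X m - X n))\<^sup>2 < \<alpha> / 2 * e\<^sup>2"
        using parallelogram[of "X m" "X n"] N close[OF that(1)] close[OF that(2)] by linarith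
      then have "(norm (X m - X n))\<^sup>2 < e\<^sup>2"
        using \<open>\<alpha> > 0\<close> by simp
      then show ?thesis
        using \<open>e > 0\<close> by (simp add: dist_norm power_less_imp_less_base)
    qed
    then show "\<exists>N. \<forall>m\<ge>N. \<forall>n\<ge>N. dist (X m) (X n) < e"
      by blast
  qed
  then obtain x where x: "X \<longlonglongrightarrow> x"
    using Cauchy_convergent_iff convergent_def by blast
  have "(\<lambda>n. J (X n)) \<longlonglongrightarrow> J x"
    unfolding J_def by (intro tendsto_intros x)
  moreover have "(\<lambda>n. I + inverse (real (Suc n))) \<longlonglongrightarrow> I + 0"
    by (intro tendsto_intros LIMSEQ_inverse_real_of_nat)
  ultimately have min: "J x \<le> I"
    using X by (metis (no_types, lifting) LIMSEQ_le add.right_neutral less_imp_le)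
  have "B x y = l y" for y
  proof -
    define d where "d = B x y - l y"
    define b where "b = B y y"
    have "b \<ge> 0"
      using coercive[of y] \<open>\<alpha> > 0\<close> unfolding b_def
      by (meson less_imp_le mult_nonneg_nonneg order_trans zero_le_power2)
    have expand: "J (x + t *\<^sub>R y) = J x + 2 * t * d + t\<^sup>2 * b" for t
      using sym[of x y]
      by (simp add: J_def d_def b_def blinfun.bilinear_simps power2_eq_square algebra_simps)
    \<comment> \<open>A step against the sign of \<open>d\<close>, short enough for the quadratic term not to compensate.\<close>
    have "0 \<le> 2 * (- d / (b + 1)) * d + (- d / (b + 1))\<^sup>2 * b"
      using expand[of "- d / (b + 1)"] I_le[of "x + (- d / (b + 1)) *\<^sub>R y"] min by linarith
    also have "\<dots> = - (d\<^sup>2 * (b + 2)) / (b + 1)\<^sup>2"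
    proof -
      have "b + 1 \<noteq> 0"
        using \<open>b \<ge> 0\<close> by simp
      then show ?thesis
        by (simp add: divide_simps) (simp add: algebra_simps power2_eq_square)
    qed
    finally have "d\<^sup>2 * (b + 2) \<le> 0"
      using \<open>b \<ge> 0\<close> by (simp add: field_simps)
    then have "d = 0"
      using \<open>b \<ge> 0\<close> by (simp add: mult_le_0_iff)
    then show ?thesis
      by (simp add: d_def)
  qed
  then show ?thesis
    by blast
qed

section \<open>Tangent vectors and their components in charts\<close>

lemma chart_homeomorphism:
  assumes "C11_atlas \<A>" "c \<in> \<A>"
  shows "open (fst c)" "open (snd c ` fst c)"
    "homeomorphism (fst c) (snd c ` fst c) (snd c) (chart_inv c)"
  using assms by (auto simp: C11_atlas_def)

lemma chart_at:
  assumes "C11_atlas \<A>"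
  obtains c where "c \<in> \<A>" "m \<in> fst c"
  using assms unfolding C11_atlas_def by blast

lemma chart_inv_chart:
  assumes "C11_atlas \<A>" "c \<in> \<A>" "m \<in> fst c"
  shows "chart_inv c (snd c m) = m"
  using homeomorphism_apply1[OF chart_homeomorphism(3)] assms by blast

lemma open_chart_image:
  assumes "C11_atlas \<A>" "c \<in> \<A>" "open U" "U \<subseteq> fst c"
  shows "open (snd c ` U)"
proof -
  note c = chart_homeomorphism[OF assms(1,2)]
  have "openin (top_of_set (snd c ` fst c)) (snd c ` U)"
    using homeomorphism_imp_open_map[OF c(3)] assms(3,4) by (simp add: open_subset)
  then show ?thesis
    using c(2) by (simp add: openin_open_eq)
qed

lemma open_chart_preimage:
  assumes "C11_atlas \<A>" "c \<in> \<A>" "open W"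
  shows "open (fst c \<inter> snd c -` W)"
  using chart_homeomorphism[OF assms(1,2)] assms(3)
  by (metis continuous_open_preimage homeomorphism_def)

lemma has_frechet_derivative_transition:
  assumes "C11_atlas \<A>" "c \<in> \<A>" "c' \<in> \<A>" "m \<in> fst c" "m \<in> fst c'"
  shows "(snd c' \<circ> chart_inv c has_derivative
           frechet_derivative (snd c' \<circ> chart_inv c) (at (snd c m))) (at (snd c m))"
proof -
  have "C11_on (snd c ` (fst c \<inter> fst c')) (snd c' \<circ> chart_inv c)"
    using assms(1-3) unfolding C11_atlas_def by blast
  then have "(snd c' \<circ> chart_inv c) differentiable (at (snd c m))"
    using assms(4,5) unfolding C11_on_def differentiable_def by blast
  then show ?thesis
    by (simp add: frechet_derivative_works)
qed

text \<open>
  The chain rule for coordinate changes.  It is applied to \<open>F = f\<close>, for the differential of \<open>f\<close>,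
  and to coordinate maps \<open>F\<close>, for the cocycle condition on the components of tangent vectors.
\<close>
lemma frechet_derivative_change_chart:
  fixes F :: "'m::t2_space \<Rightarrow> 'b::real_normed_vector"
    and \<A> :: "('m, 'e::{real_inner,banach}) chart set"
  assumes "C11_atlas \<A>" "c \<in> \<A>" "c' \<in> \<A>" "m \<in> fst c" "m \<in> fst c'"
    and F: "(F \<circ> chart_inv c') differentiable (at (snd c' m))"
  shows "frechet_derivative (F \<circ> chart_inv c) (at (snd c m)) x =
    frechet_derivative (F \<circ> chart_inv c') (at (snd c' m))
      (frechet_derivative (snd c' \<circ> chart_inv c) (at (snd c m)) x)"
proof -
  let ?T = "snd c' \<circ> chart_inv c"
  let ?DT = "frechet_derivative ?T (at (snd c m))"
  let ?DF = "frechet_derivative (F \<circ> chart_inv c') (at (snd c' m))"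
  have T: "?T (snd c m) = snd c' m"
    using assms by (simp add: chart_inv_chart)
  have "((F \<circ> chart_inv c') \<circ> ?T has_derivative ?DF \<circ> ?DT) (at (snd c m))"
    using has_frechet_derivative_transition[OF assms(1-5)] F T
    by (intro diff_chain_at) (auto simp: frechet_derivative_works)
  moreover have "open (snd c ` (fst c \<inter> fst c'))"
    using assms(1-3) by (intro open_chart_image open_Int chart_homeomorphism(1)) auto
  moreover have "((F \<circ> chart_inv c') \<circ> ?T) q = (F \<circ> chart_inv c) q"
    if "q \<in> snd c ` (fst c \<inter> fst c')" for q
    using that assms(1-3) by (auto simp: chart_inv_chart)
  ultimately have "(F \<circ> chart_inv c has_derivative ?DF \<circ> ?DT) (at (snd c m))"
    using has_derivative_transform_within_open assms(4,5) by blast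
  then show ?thesis
    using frechet_derivative_at[symmetric] by (metis comp_apply)
qed

text \<open>
  Together with \<open>tangent_vector_eqI\<close> below, this identifies the tangent space with the model
  space through any one chart; the remaining components are images under the derivatives
  of the coordinate changes, and are consistent by the chain rule.
\<close>
lemma tangent_vector_with_component:
  fixes \<A> :: "('m::t2_space, 'e::{real_inner,banach}) chart set"
  assumes \<A>: "C11_atlas \<A>" and c: "c \<in> \<A>" "m \<in> fst c"
  obtains v where "v \<in> tangent_space \<A> m" "v c = x"
proof -
  define v where "v c' = (if c' \<in> \<A> \<and> m \<in> fst c'
    then frechet_derivative (snd c' \<circ> chart_inv c) (at (snd c m)) x else 0)" for c'
  have "v c'' = frechet_derivative (snd c'' \<circ> chart_inv c') (at (snd c' m)) (v c')"
    if "c' \<in> \<A>" "c'' \<in> \<A>" "m \<in> fst c'" "m \<in> fst c''" for c' c''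
    using that c has_frechet_derivative_transition[OF \<A> that]
      frechet_derivative_change_chart[OF \<A> c(1) that(1) c(2) that(3), of "snd c''" x]
    by (auto simp: v_def differentiable_def)
  moreover have "v c' = 0" if "\<not> (c' \<in> \<A> \<and> m \<in> fst c')" for c'
    using that by (auto simp: v_def)
  ultimately have "v \<in> tangent_space \<A> m"
    unfolding tangent_space_def by blast
  moreover have "v c = x"
  proof -
    have "(snd c \<circ> chart_inv c has_derivative id) (at (snd c m))"
    proof (rule has_derivative_transform_within_open[where f = id])
      show "(id has_derivative id) (at (snd c m))"
        by (simp add: id_def)
      show "open (snd c ` fst c)" "snd c m \<in> snd c ` fst c"
        using chart_homeomorphism[OF \<A> c(1)] c(2) by auto
    qed (auto simp: chart_inv_chart[OF \<A> c(1)])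
    then have "frechet_derivative (snd c \<circ> chart_inv c) (at (snd c m)) = id"
      using frechet_derivative_at by metis
    then show ?thesis
      using c by (simp add: v_def)
  qed
  ultimately show ?thesis
    using that by blast
qed

lemma tangent_vector_change_chart:
  assumes "v \<in> tangent_space \<A> m" "c \<in> \<A>" "c' \<in> \<A>" "m \<in> fst c" "m \<in> fst c'"
  shows "frechet_derivative (snd c' \<circ> chart_inv c) (at (snd c m)) (v c) = v c'"
proof -
  have "v c' = frechet_derivative (snd c' \<circ> chart_inv c) (at (snd c m)) (v c)"
    using assms unfolding tangent_space_def by blast
  then show ?thesis
    by (rule sym)
qed

lemma tangent_vector_eqI:
  assumes \<A>: "C11_atlas \<A>" and c: "c \<in> \<A>" "m \<in> fst c"
    and "v \<in> tangent_space \<A> m" "w \<in> tangent_space \<A> m" "v c = w c"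
  shows "v = w"
proof
  fix c'
  show "v c' = w c'"
  proof (cases "c' \<in> \<A> \<and> m \<in> fst c'")
    case True
    then show ?thesis
      using tangent_vector_change_chart[of _ \<A> m c c'] c assms(4-6) by metis
  next
    case False
    then have "u c' = 0" if "u \<in> tangent_space \<A> m" for u
      using that unfolding tangent_space_def by blast
    from this[OF assms(4)] this[OF assms(5)] show ?thesis
      by simp
  qed
qed

lemma zero_in_tangent_space:
  assumes "C11_atlas \<A>"
  shows "(\<lambda>c. 0) \<in> tangent_space \<A> m"
proof -
  have "frechet_derivative (snd c' \<circ> chart_inv c) (at (snd c m)) 0 = 0"
    if "c \<in> \<A>" "c' \<in> \<A>" "m \<in> fst c" "m \<in> fst c'" for c c'
  proof -
    note has_frechet_derivative_transition[OF assms that]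
    then have "linear (frechet_derivative (snd c' \<circ> chart_inv c) (at (snd c m)))"
      by (rule has_derivative_linear)
    then show ?thesis
      by (rule linear_0)
  qed
  then show ?thesis
    unfolding tangent_space_def mem_Collect_eq by metis
qed

section \<open>The gradient\<close>

lemma C11_function_derivative:
  assumes "C11_function \<A> f" "c \<in> \<A>"
  obtains f' where "\<And>q. q \<in> snd c ` fst c \<Longrightarrow>
      (f \<circ> chart_inv c has_derivative blinfun_apply (f' q)) (at q)"
    "locally_lipschitz_on (snd c ` fst c) f'"
  using assms unfolding C11_function_def C11_on_def by blast

lemma riemannian_metric_in_chart:
  assumes "riemannian_metric_C01 \<A> ip" "c \<in> \<A>"
  obtains G where "locally_lipschitz_on (snd c ` fst c) G"
    "\<And>m v w. m \<in> fst c \<Longrightarrow> v \<in> tangent_space \<A> m \<Longrightarrow> w \<in> tangent_space \<A> m \<Longrightarrow>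
      ip m v w = blinfun_apply (blinfun_apply (G (snd c m)) (v c)) (w c)"
    "\<And>m x y. m \<in> fst c \<Longrightarrow> blinfun_apply (blinfun_apply (G (snd c m)) x) y =
      blinfun_apply (blinfun_apply (G (snd c m)) y) x"
    "\<And>m. m \<in> fst c \<Longrightarrow>
      \<exists>\<alpha>>0. \<forall>x. \<alpha> * (norm x)\<^sup>2 \<le> blinfun_apply (blinfun_apply (G (snd c m)) x) x"
  using assms unfolding riemannian_metric_C01_def by metis

lemma differential_in_chart:
  assumes \<A>: "C11_atlas \<A>" and f: "C11_function \<A> f"
    and c: "c \<in> \<A>" "m \<in> fst c" and v: "v \<in> tangent_space \<A> m"
  shows "differential \<A> f m v = frechet_derivative (f \<circ> chart_inv c) (at (snd c m)) (v c)"
proof -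
  define d where "d = (SOME c. c \<in> \<A> \<and> m \<in> fst c)"
  have d: "d \<in> \<A>" "m \<in> fst d"
    using someI[of "\<lambda>c. c \<in> \<A> \<and> m \<in> fst c" c] c unfolding d_def by auto
  have "(f \<circ> chart_inv d) differentiable (at (snd d m))"
    using C11_function_derivative[OF f d(1)] d(2) unfolding differentiable_def by blast
  then have "frechet_derivative (f \<circ> chart_inv c) (at (snd c m)) (v c) =
      frechet_derivative (f \<circ> chart_inv d) (at (snd d m))
        (frechet_derivative (snd d \<circ> chart_inv c) (at (snd c m)) (v c))"
    by (rule frechet_derivative_change_chart[OF \<A> c(1) d(1) c(2) d(2)])
  also have "frechet_derivative (snd d \<circ> chart_inv c) (at (snd c m)) (v c) = v d"
    by (rule tangent_vector_change_chart[OF v c(1) d(1) c(2) d(2)])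
  finally show ?thesis
    unfolding differential_def Let_def d_def[symmetric] by (rule sym)
qed

lemma ip_self_nonneg:
  assumes \<A>: "C11_atlas \<A>" and ip: "riemannian_metric_C01 \<A> ip"
    and v: "v \<in> tangent_space \<A> m"
  shows "0 \<le> ip m v v"
    and "ip m v v = 0 \<Longrightarrow> v = (\<lambda>c. 0)"
proof -
  obtain c where c: "c \<in> \<A>" "m \<in> fst c"
    using chart_at[OF \<A>] .
  obtain G where G: "\<And>v w. v \<in> tangent_space \<A> m \<Longrightarrow> w \<in> tangent_space \<A> m \<Longrightarrow>
      ip m v w = blinfun_apply (blinfun_apply (G (snd c m)) (v c)) (w c)"
    "\<exists>\<alpha>>0. \<forall>x. \<alpha> * (norm x)\<^sup>2 \<le> blinfun_apply (blinfun_apply (G (snd c m)) x) x"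
    using riemannian_metric_in_chart[OF ip c(1)] c(2) by metis
  then obtain \<alpha> where \<alpha>: "\<alpha> > 0" "\<alpha> * (norm (v c))\<^sup>2 \<le> ip m v v"
    using v by metis
  then show "0 \<le> ip m v v"
    by (meson less_imp_le mult_nonneg_nonneg order_trans zero_le_power2)
  assume "ip m v v = 0"
  then have "v c = 0"
    using \<alpha> by (simp add: mult_le_0_iff)
  then show "v = (\<lambda>c. 0)"
    using tangent_vector_eqI[OF \<A> c v zero_in_tangent_space[OF \<A>]] by simp
qed

text \<open>
  The gradient is a definite description, so it has its defining property only once a
  representing vector is shown to exist and to be unique.  Existence is the
  representation theorem for the metric in a chart; uniqueness is positive definiteness.
\<close>
lemma gradient_represents_differential:
  fixes \<A> :: "('m::t2_space, 'e::{real_inner,banach}) chart set"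
  assumes \<A>: "C11_atlas \<A>" and ip: "riemannian_metric_C01 \<A> ip" and f: "C11_function \<A> f"
  shows "gradient \<A> ip f m \<in> tangent_space \<A> m"
    and "\<And>v. v \<in> tangent_space \<A> m \<Longrightarrow> differential \<A> f m v = ip m (gradient \<A> ip f m) v"
proof -
  let ?P = "\<lambda>X. X \<in> tangent_space \<A> m \<and>
    (\<forall>v\<in>tangent_space \<A> m. differential \<A> f m v = ip m X v)"
  obtain c where c: "c \<in> \<A>" "m \<in> fst c"
    using chart_at[OF \<A>] .
  obtain G where G: "\<And>v w. v \<in> tangent_space \<A> m \<Longrightarrow> w \<in> tangent_space \<A> m \<Longrightarrow>
      ip m v w = blinfun_apply (blinfun_apply (G (snd c m)) (v c)) (w c)"
    "\<And>x y. blinfun_apply (blinfun_apply (G (snd c m)) x) y =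
      blinfun_apply (blinfun_apply (G (snd c m)) y) x"
    "\<exists>\<alpha>>0. \<forall>x. \<alpha> * (norm x)\<^sup>2 \<le> blinfun_apply (blinfun_apply (G (snd c m)) x) x"
    using riemannian_metric_in_chart[OF ip c(1)] c(2) by metis
  obtain \<alpha> where \<alpha>: "\<alpha> > 0" "\<And>x. \<alpha> * (norm x)\<^sup>2 \<le> G (snd c m) x x"
    using G(3) by blast
  obtain f' where "\<And>q. q \<in> snd c ` fst c \<Longrightarrow>
      (f \<circ> chart_inv c has_derivative blinfun_apply (f' q)) (at q)"
    using C11_function_derivative[OF f c(1)] by metis
  then have "frechet_derivative (f \<circ> chart_inv c) (at (snd c m)) = f' (snd c m)"
    using c(2) frechet_derivative_at by (metis imageI)
  then have df: "differential \<A> f m v = f' (snd c m) (v c)" if "v \<in> tangent_space \<A> m" for v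
    using differential_in_chart[OF \<A> f c that] by simp
  obtain x where x: "\<And>y. G (snd c m) x y = f' (snd c m) y"
    using coercive_symmetric_form_represents[OF G(2) \<alpha>] by blast
  obtain X where X: "X \<in> tangent_space \<A> m" "X c = x"
    using tangent_vector_with_component[OF \<A> c] .
  have "?P X"
    using X x df G(1) by simp
  moreover have "Y = X" if Y: "?P Y" for Y
  proof -
    obtain v where v: "v \<in> tangent_space \<A> m" "v c = Y c - X c"
      using tangent_vector_with_component[OF \<A> c] .
    have "ip m Y v = ip m X v"
      using Y \<open>?P X\<close> v(1) by metis
    then have "G (snd c m) (Y c - X c) (Y c - X c) = 0"
      using G(1) X(1) Y v by (simp add: blinfun.bilinear_simps)
    then have "Y c = X c"
      using \<alpha>(1) \<alpha>(2)[of "Y c - X c"] by (simp add: mult_le_0_iff)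
    then show ?thesis
      using tangent_vector_eqI[OF \<A> c] X(1) Y by blast
  qed
  ultimately have "?P (gradient \<A> ip f m)"
    unfolding gradient_def by (rule theI)
  then show "gradient \<A> ip f m \<in> tangent_space \<A> m"
    and "\<And>v. v \<in> tangent_space \<A> m \<Longrightarrow> differential \<A> f m v = ip m (gradient \<A> ip f m) v"
    by auto
qed

text \<open>
  If \<open>X\<close> is the gradient at \<open>q\<close> in the chart, \<open>G\<close> the metric with
  \<open>\<alpha> \<parallel>X\<parallel>\<^sup>2 \<le> G p X X\<close>, and \<open>K\<close> a Lipschitz constant of \<open>Df\<close> near \<open>p\<close>, then
  \<open>\<alpha>/2 \<parallel>X\<parallel>\<^sup>2 \<le> G q X X = Df q X \<le> \<parallel>Df q - Df p\<parallel> \<parallel>X\<parallel> \<le> K \<parallel>q - p\<parallel> \<parallel>X\<parallel>\<close>,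
  because \<open>Df p = 0\<close>.
\<close>
lemma gradient_linear_bound_at_critical_point:
  fixes \<A> :: "('m::t2_space, 'e::{real_inner,banach}) chart set"
  assumes \<A>: "C11_atlas \<A>" and ip: "riemannian_metric_C01 \<A> ip" and f: "C11_function \<A> f"
    and c: "c \<in> \<A>" "p \<in> fst c" and crit: "critical_point \<A> ip f p"
  obtains r L where "r > 0" "L \<ge> 0" "ball (snd c p) r \<subseteq> snd c ` fst c"
    "\<And>m. m \<in> fst c \<Longrightarrow> snd c m \<in> ball (snd c p) r \<Longrightarrow>
      norm (gradient \<A> ip f m c) \<le> L * norm (snd c m - snd c p)"
proof -
  let ?p = "snd c p" and ?S = "snd c ` fst c"
  have p: "?p \<in> ?S"
    using c(2) by blast
  obtain G where G: "locally_lipschitz_on ?S G"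
    "\<And>m v w. m \<in> fst c \<Longrightarrow> v \<in> tangent_space \<A> m \<Longrightarrow> w \<in> tangent_space \<A> m \<Longrightarrow>
      ip m v w = blinfun_apply (blinfun_apply (G (snd c m)) (v c)) (w c)"
    "\<And>m. m \<in> fst c \<Longrightarrow>
      \<exists>\<alpha>>0. \<forall>x. \<alpha> * (norm x)\<^sup>2 \<le> blinfun_apply (blinfun_apply (G (snd c m)) x) x"
    using riemannian_metric_in_chart[OF ip c(1)] by metis
  obtain f' where f': "\<And>q. q \<in> ?S \<Longrightarrow>
      (f \<circ> chart_inv c has_derivative blinfun_apply (f' q)) (at q)"
    "locally_lipschitz_on ?S f'"
    using C11_function_derivative[OF f c(1)] by metis
  have df: "ip m (gradient \<A> ip f m) v = f' (snd c m) (v c)"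
    if "m \<in> fst c" "v \<in> tangent_space \<A> m" for m v
    using differential_in_chart[OF \<A> f c(1) that] frechet_derivative_at[OF f'(1)] that
      gradient_represents_differential(2)[OF \<A> ip f that(2)] by (metis imageI)
  have f'p: "f' ?p = 0"
  proof (rule blinfun_eqI)
    fix x
    obtain v where v: "v \<in> tangent_space \<A> p" "v c = x"
      using tangent_vector_with_component[OF \<A> c] .
    have "f' ?p x = G ?p (gradient \<A> ip f p c) x"
      using df[OF c(2) v(1)] v G(2)[OF c(2) gradient_represents_differential(1)[OF \<A> ip f] v(1)]
      by simp
    also have "\<dots> = 0"
      using crit by (simp add: critical_point_def)
    finally show "f' ?p x = blinfun_apply 0 x"
      by simp
  qed
  obtain u K where u: "u > 0" and K: "K-lipschitz_on (ball ?p u \<inter> ?S) f'"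
    using f'(2) p unfolding locally_lipschitz_on_def by blast
  obtain u' K' where u': "u' > 0" and K': "K'-lipschitz_on (ball ?p u' \<inter> ?S) G"
    using G(1) p unfolding locally_lipschitz_on_def by blast
  obtain \<alpha> where \<alpha>: "\<alpha> > 0" "\<And>x. \<alpha> * (norm x)\<^sup>2 \<le> G ?p x x"
    using G(3)[OF c(2)] by blast
  obtain s where s: "s > 0" "ball ?p s \<subseteq> ?S"
    using chart_homeomorphism(2)[OF \<A> c(1)] p open_contains_ball by blast
  have "K \<ge> 0" "K' \<ge> 0"
    using K K' by (auto simp: lipschitz_on_def)
  \<comment> \<open>On the ball of radius \<open>r\<close> the metric keeps half of its coercivity constant at \<open>p\<close>.\<close>
  define r where "r = Min {u, u', s, \<alpha> / (2 * (K' + 1))}"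
  have r: "r > 0" "r \<le> u" "r \<le> u'" "r \<le> s" "r \<le> \<alpha> / (2 * (K' + 1))"
    using u u' s \<alpha> \<open>K' \<ge> 0\<close> unfolding r_def by auto
  show ?thesis
  proof (rule that[of r "2 * K / \<alpha>"])
    show "r > 0" "2 * K / \<alpha> \<ge> 0" "ball ?p r \<subseteq> ?S"
      using r s \<open>K \<ge> 0\<close> \<alpha> by (auto simp: subset_ball)
  next
    fix m assume m: "m \<in> fst c" "snd c m \<in> ball ?p r"
    let ?q = "snd c m"
    define X where "X = gradient \<A> ip f m c"
    have q: "?q \<in> ball ?p u \<inter> ?S" "?q \<in> ball ?p u' \<inter> ?S"
        "?p \<in> ball ?p u \<inter> ?S" "?p \<in> ball ?p u' \<inter> ?S"
      using m r p u u' by auto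
    have dist: "dist ?q ?p < \<alpha> / (2 * (K' + 1))"
      using m(2) r by (simp add: dist_commute)
    have "norm (G ?q - G ?p) \<le> K' * dist ?q ?p"
      using lipschitz_onD[OF K' q(2,4)] by (simp add: dist_norm)
    also have "\<dots> \<le> (K' + 1) * (\<alpha> / (2 * (K' + 1)))"
      using dist \<open>K' \<ge> 0\<close> by (intro mult_mono) auto
    also have "\<dots> = \<alpha> / 2"
      using \<open>K' \<ge> 0\<close> by (simp add: field_simps)
    finally have G_close: "norm (G ?q - G ?p) \<le> \<alpha> / 2" .
    have "\<bar>(G ?q - G ?p) X X\<bar> \<le> norm ((G ?q - G ?p) X) * norm X"
      using norm_blinfun[of "(G ?q - G ?p) X" X] by simp
    also have "\<dots> \<le> norm (G ?q - G ?p) * norm X * norm X"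
      by (intro mult_right_mono norm_blinfun) auto
    also have "\<dots> \<le> \<alpha> / 2 * norm X * norm X"
      using G_close by (intro mult_right_mono) auto
    finally have "\<bar>G ?q X X - G ?p X X\<bar> \<le> \<alpha> / 2 * (norm X)\<^sup>2"
      by (simp add: blinfun.bilinear_simps power2_eq_square mult.assoc)
    then have "\<alpha> / 2 * (norm X)\<^sup>2 \<le> G ?q X X"
      using \<alpha>(2)[of X] by linarith
    also have "\<dots> = f' ?q X"
      using df[OF m(1)] G(2)[OF m(1)] gradient_represents_differential(1)[OF \<A> ip f, of m]
      by (simp add: X_def)
    also have "\<dots> \<le> norm (f' ?q) * norm X"
      using norm_blinfun[of "f' ?q" X] by simp
    also have "norm (f' ?q) \<le> K * dist ?q ?p"
      using lipschitz_onD[OF K q(1,3)] f'p by (simp add: dist_norm)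
    finally have "\<alpha> / 2 * norm X * norm X \<le> K * dist ?q ?p * norm X"
      by (simp add: mult_right_mono power2_eq_square)
    then have "\<alpha> / 2 * norm X \<le> K * dist ?q ?p"
      using \<open>K \<ge> 0\<close> by (cases "X = 0") auto
    then show "norm (gradient \<A> ip f m c) \<le> 2 * K / \<alpha> * norm (?q - ?p)"
      using \<alpha>(1) by (simp add: X_def dist_norm field_simps)
  qed
qed

section \<open>Flow lines near a critical point\<close>

text \<open>
  The function \<open>exp (- 2 L t) \<parallel>u t - p\<parallel>\<^sup>2\<close> is nonincreasing: its derivative is
  \<open>2 exp (- 2 L t) ((u t - p) \<bullet> u' t - L \<parallel>u t - p\<parallel>\<^sup>2)\<close>.
\<close>
lemma gronwall_norm_bound:
  fixes u :: "real \<Rightarrow> 'e::real_inner"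
  assumes "a \<le> b"
    and deriv: "\<And>t. a \<le> t \<Longrightarrow> t \<le> b \<Longrightarrow>
      \<exists>w. (u has_vector_derivative w) (at t) \<and> norm w \<le> L * norm (u t - p)"
  shows "norm (u b - p) \<le> exp (L * (b - a)) * norm (u a - p)"
proof -
  define F where "F t = exp (- 2 * L * t) * ((u t - p) \<bullet> (u t - p))" for t
  have "F b \<le> F a"
  proof (rule DERIV_nonpos_imp_nonincreasing[OF \<open>a \<le> b\<close>])
    fix t assume "a \<le> t" "t \<le> b"
    then obtain w where w: "(u has_vector_derivative w) (at t)" "norm w \<le> L * norm (u t - p)"
      using deriv by blast
    have "((\<lambda>t. (u t - p) \<bullet> (u t - p)) has_derivative
        (\<lambda>s. (u t - p) \<bullet> (s *\<^sub>R w) + (s *\<^sub>R w) \<bullet> (u t - p))) (at t)"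
      using w(1) unfolding has_vector_derivative_def
      by (auto intro!: derivative_eq_intros)
    then have "((\<lambda>t. (u t - p) \<bullet> (u t - p)) has_real_derivative 2 * ((u t - p) \<bullet> w)) (at t)"
      by (rule has_derivative_imp_has_field_derivative) (simp add: inner_commute)
    moreover have "((\<lambda>t. exp (- 2 * L * t)) has_real_derivative exp (- 2 * L * t) * (- 2 * L)) (at t)"
      by (auto intro!: derivative_eq_intros)
    ultimately have "(F has_real_derivative
        exp (- 2 * L * t) * (- 2 * L) * ((u t - p) \<bullet> (u t - p)) +
        2 * ((u t - p) \<bullet> w) * exp (- 2 * L * t)) (at t)"
      unfolding F_def by (rule DERIV_mult[rotated])
    moreover have "exp (- 2 * L * t) * (- 2 * L) * ((u t - p) \<bullet> (u t - p)) +
        2 * ((u t - p) \<bullet> w) * exp (- 2 * L * t) =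
        exp (- 2 * L * t) * (2 * ((u t - p) \<bullet> w - L * ((u t - p) \<bullet> (u t - p))))"
      by (simp only: algebra_simps)
    moreover have "(u t - p) \<bullet> w \<le> L * ((u t - p) \<bullet> (u t - p))"
    proof -
      have "(u t - p) \<bullet> w \<le> norm (u t - p) * norm w"
        by (rule norm_cauchy_schwarz)
      also have "\<dots> \<le> norm (u t - p) * (L * norm (u t - p))"
        using w(2) by (intro mult_left_mono) auto
      finally show ?thesis
        by (simp add: dot_square_norm power2_eq_square mult_ac)
    qed
    ultimately show "\<exists>y. (F has_real_derivative y) (at t) \<and> y \<le> 0"
      by (intro exI conjI) (assumption, simp only: mult_le_0_iff, simp)
  qed
  then have "exp (2 * L * b) * F b \<le> exp (2 * L * b) * F a"
    by simp
  moreover have "exp (2 * L * b) * F t = (exp (L * (b - t)) * norm (u t - p))\<^sup>2" for t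
  proof -
    have "exp (2 * L * b) * F t = exp (2 * L * b + - 2 * L * t) * (norm (u t - p))\<^sup>2"
      by (simp only: F_def exp_add mult.assoc dot_square_norm)
    also have "2 * L * b + - 2 * L * t = 2 * (L * (b - t))"
      by (simp add: algebra_simps)
    finally show ?thesis
      by (simp only: exp_double power_mult_distrib)
  qed
  ultimately have "(norm (u b - p))\<^sup>2 \<le> (exp (L * (b - a)) * norm (u a - p))\<^sup>2"
    by simp
  then show ?thesis
    by (rule power2_le_imp_le) simp
qed

text \<open>
  Gronwall's inequality keeps the coordinates of the curve within a radius \<open>R < r\<close> of \<open>p\<close> up to the
  first time \<open>s\<close> at which the curve leaves \<open>U\<close>.  The preimage of a closed coordinate ball need
  not be closed in the manifold, as the ball is not compact in infinite dimension, so this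
  alone does not place \<open>\<sigma> s\<close> in the chart.  But the coordinates are Lipschitz on \<open>{0..<s}\<close> and
  converge to a point \<open>q\<close> of the open ball by completeness of the model space; the point with coordinates
  \<open>q\<close> is then a limit of the curve, hence equal to \<open>\<sigma> s\<close> since the manifold is Hausdorff.  So the
  curve is still in the open set \<open>U\<close> at time \<open>s\<close>, and shortly after.
\<close>
lemma curve_stays_in_chart_ball:
  fixes \<A> :: "('m::t2_space, 'e::{real_inner,banach}) chart set" and \<sigma> :: "real \<Rightarrow> 'm"
  assumes \<A>: "C11_atlas \<A>" and c: "c \<in> \<A>"
    and ball: "ball p r \<subseteq> snd c ` fst c" and "r > 0" "L \<ge> 0"
  defines "U \<equiv> fst c \<inter> snd c -` ball p r"
  assumes cont: "\<And>t. 0 \<le> t \<Longrightarrow> t \<le> T \<Longrightarrow> isCont \<sigma> t"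
    and deriv: "\<And>t. 0 \<le> t \<Longrightarrow> t \<le> T \<Longrightarrow> \<sigma> t \<in> U \<Longrightarrow>
      \<exists>w. (snd c \<circ> \<sigma> has_vector_derivative w) (at t) \<and> norm w \<le> L * norm (snd c (\<sigma> t) - p)"
    and start: "\<sigma> 0 \<in> U" "exp (L * T) * norm (snd c (\<sigma> 0) - p) < r"
    and t: "0 \<le> t" "t \<le> T"
  shows "\<sigma> t \<in> U"
proof (rule ccontr)
  assume "\<sigma> t \<notin> U"
  define E where "E = {t. 0 \<le> t \<and> t \<le> T \<and> \<sigma> t \<notin> U}"
  define s where "s = Inf E"
  have "E \<noteq> {}" "bdd_below E"
    using t \<open>\<sigma> t \<notin> U\<close> unfolding E_def by (auto intro!: bdd_belowI[of _ 0])
  have s: "0 \<le> s" "s \<le> T"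
  proof -
    show "0 \<le> s"
      unfolding s_def using \<open>E \<noteq> {}\<close> by (intro cInf_greatest) (auto simp: E_def)
    have "s \<le> t"
      unfolding s_def using \<open>bdd_below E\<close> t \<open>\<sigma> t \<notin> U\<close>
      by (intro cInf_lower) (auto simp: E_def)
    then show "s \<le> T"
      using t by simp
  qed
  have before: "\<sigma> t \<in> U" if "0 \<le> t" "t < s" for t
  proof (rule ccontr)
    assume "\<sigma> t \<notin> U"
    then have "t \<in> E"
      using that s by (simp add: E_def)
    then have "s \<le> t"
      unfolding s_def using \<open>bdd_below E\<close> by (rule cInf_lower)
    then show False
      using that by simp
  qed
  let ?u = "snd c \<circ> \<sigma>"
  define R where "R = exp (L * T) * norm (snd c (\<sigma> 0) - p)"
  have u_deriv: "\<exists>w. (?u has_vector_derivative w) (at t) \<and> norm w \<le> L * norm (?u t - p)"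
    if "t \<in> {0..<s}" for t
    using that deriv[of t] before[of t] s by simp
  have u_near: "norm (?u t - p) \<le> R" if "0 \<le> t" "t < s" for t
  proof -
    have "norm (?u t - p) \<le> exp (L * (t - 0)) * norm (?u 0 - p)"
      using that by (intro gronwall_norm_bound u_deriv) auto
    also have "\<dots> \<le> R"
      unfolding R_def using that s \<open>L \<ge> 0\<close> by (auto intro!: mult_right_mono mult_left_mono)
    finally show ?thesis .
  qed
  have "\<sigma> s \<in> U"
  proof (cases "s = 0")
    case True
    then show ?thesis
      using start by simp
  next
    case False
    then have "s > 0"
      using s by simp
    obtain w where w: "\<And>t. t \<in> {0..<s} \<Longrightarrow> (?u has_vector_derivative w t) (at t)"
      "\<And>t. t \<in> {0..<s} \<Longrightarrow> norm (w t) \<le> L * norm (snd c (\<sigma> t) - p)"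
      using u_deriv by (metis comp_apply)
    have "(L * r)-lipschitz_on {0..<s} ?u"
    proof (rule bounded_derivative_imp_lipschitz)
      fix t assume t: "t \<in> {0..<s}"
      show "(?u has_derivative (\<lambda>x. x *\<^sub>R w t)) (at t within {0..<s})"
        using w(1)[OF t] unfolding has_vector_derivative_def by (rule has_derivative_at_withinI)
      have "norm (snd c (\<sigma> t) - p) \<le> r"
        using before[of t] t by (simp add: U_def dist_norm norm_minus_commute)
      then have "norm (w t) \<le> L * r"
        using w(2)[OF t] \<open>L \<ge> 0\<close> by (meson mult_left_mono order_trans)
      then show "onorm (\<lambda>x. x *\<^sub>R w t) \<le> L * r"
        by (simp add: onorm_scaleR_left[OF bounded_linear_ident] onorm_id)
    qed (use \<open>r > 0\<close> \<open>L \<ge> 0\<close> in auto)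
    then have "uniformly_continuous_on {0..<s} ?u"
      by (rule lipschitz_on_uniformly_continuous)
    define X where "X n = s - s / real (Suc n)" for n
    have X: "0 \<le> X n" "X n < s" for n
      using \<open>s > 0\<close> by (auto simp: X_def field_simps)
    have "X \<longlonglongrightarrow> s - 0"
      unfolding X_def by (intro tendsto_intros LIMSEQ_Suc lim_const_over_n)
    then have X_lim: "X \<longlonglongrightarrow> s"
      by simp
    then have "Cauchy (\<lambda>n. ?u (X n))"
      using uniformly_continuous_on_Cauchy[OF \<open>uniformly_continuous_on {0..<s} ?u\<close>] X
      by (simp add: LIMSEQ_imp_Cauchy)
    then obtain q where q: "(\<lambda>n. ?u (X n)) \<longlonglongrightarrow> q"
      using Cauchy_convergent_iff convergent_def by blast
    have "(\<lambda>n. norm (?u (X n) - p)) \<longlonglongrightarrow> norm (q - p)"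
      by (intro tendsto_intros q)
    then have "norm (q - p) \<le> R"
      using u_near X by (intro LIMSEQ_le_const2) auto
    then have q_ball: "q \<in> ball p r"
      using start(2) by (simp add: R_def dist_norm norm_minus_commute)
    then obtain m where m: "m \<in> fst c" "q = snd c m"
      using ball by blast
    have "continuous_on (snd c ` fst c) (chart_inv c)"
      using chart_homeomorphism(3)[OF \<A> c] by (simp add: homeomorphism_def)
    then have "isCont (chart_inv c) q"
      using chart_homeomorphism(2)[OF \<A> c] m by (simp add: continuous_on_eq_continuous_at)
    then have "(\<lambda>n. chart_inv c (?u (X n))) \<longlonglongrightarrow> chart_inv c q"
      using q by (rule isCont_tendsto_compose)
    moreover have "chart_inv c (?u (X n)) = \<sigma> (X n)" for n
      using before[OF X] chart_inv_chart[OF \<A> c] by (simp add: U_def)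
    moreover have "(\<lambda>n. \<sigma> (X n)) \<longlonglongrightarrow> \<sigma> s"
      using cont[OF s] X_lim by (rule isCont_tendsto_compose)
    ultimately have "\<sigma> s = chart_inv c q"
      using LIMSEQ_unique by auto
    then show ?thesis
      using m q_ball chart_inv_chart[OF \<A> c] by (simp add: U_def)
  qed
  moreover have "open U"
    unfolding U_def by (rule open_chart_preimage[OF \<A> c open_ball])
  ultimately have "eventually (\<lambda>t. \<sigma> t \<in> U) (nhds s)"
    using cont[OF s] unfolding continuous_at_open eventually_nhds by blast
  then obtain d where d: "d > 0" "\<And>t. dist t s < d \<Longrightarrow> \<sigma> t \<in> U"
    unfolding eventually_nhds_metric by blast
  obtain t where "t \<in> E" "t < s + d"
    using cInf_lessD[OF \<open>E \<noteq> {}\<close>, of "s + d"] d(1) unfolding s_def by auto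
  moreover have "s \<le> t"
    unfolding s_def using \<open>bdd_below E\<close> \<open>t \<in> E\<close> by (rule cInf_lower[rotated])
  ultimately show False
    using d(2)[of t] by (simp add: E_def dist_real_def)
qed

text \<open>
  Both time directions are covered: a flow line run backwards satisfies the same
  velocity bound.  The neighbourhood \<open>W'\<close> is a coordinate ball shrunk by the factor
  \<open>exp (- L T)\<close> that Gronwall's inequality gives away.
\<close>
lemma flow_stable_near_critical_point:
  fixes \<A> :: "('m::t2_space, 'e::{real_inner,banach}) chart set"
  assumes \<A>: "C11_atlas \<A>" and ip: "riemannian_metric_C01 \<A> ip" and f: "C11_function \<A> f"
    and flow: "is_flow \<A> (\<lambda>m c. - (h m *\<^sub>R gradient \<A> ip f m c)) \<phi>"
    and h: "\<And>m. \<bar>h m\<bar> \<le> 1"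
    and crit: "critical_point \<A> ip f p" and W: "open W" "p \<in> W"
  obtains W' where "open W'" "p \<in> W'"
    "\<And>x s t. \<phi> s x \<in> W' \<Longrightarrow> \<bar>t - s\<bar> \<le> T \<Longrightarrow> \<phi> t x \<in> W"
proof -
  obtain c where c: "c \<in> \<A>" "p \<in> fst c"
    using chart_at[OF \<A>] .
  obtain r\<^sub>0 L where r\<^sub>0: "r\<^sub>0 > 0" "L \<ge> 0" "ball (snd c p) r\<^sub>0 \<subseteq> snd c ` fst c"
    "\<And>m. m \<in> fst c \<Longrightarrow> snd c m \<in> ball (snd c p) r\<^sub>0 \<Longrightarrow>
      norm (gradient \<A> ip f m c) \<le> L * norm (snd c m - snd c p)"
    using gradient_linear_bound_at_critical_point[OF \<A> ip f c crit] by metis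
  have "open (snd c ` (fst c \<inter> W))"
    using W(1) chart_homeomorphism(1)[OF \<A> c(1)] by (intro open_chart_image[OF \<A> c(1)]) auto
  then obtain r\<^sub>1 where r\<^sub>1: "r\<^sub>1 > 0" "ball (snd c p) r\<^sub>1 \<subseteq> snd c ` (fst c \<inter> W)"
    using c(2) W(2) open_contains_ball by blast
  define r where "r = min r\<^sub>0 r\<^sub>1"
  have r: "r > 0" "ball (snd c p) r \<subseteq> snd c ` fst c" "ball (snd c p) r \<subseteq> ball (snd c p) r\<^sub>0"
    "ball (snd c p) r \<subseteq> snd c ` (fst c \<inter> W)"
    using r\<^sub>0 r\<^sub>1 by (auto simp: r_def)
  \<comment> \<open>The absolute value keeps \<open>W'\<close> inside the ball of radius \<open>r\<close> for every real \<open>T\<close>.\<close>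
  define W' where "W' = fst c \<inter> snd c -` ball (snd c p) (exp (- (L * \<bar>T\<bar>)) * r)"
  show ?thesis
  proof (rule that[of W'])
    show "open W'"
      unfolding W'_def by (rule open_chart_preimage[OF \<A> c(1) open_ball])
    show "p \<in> W'"
      using c(2) r(1) by (simp add: W'_def)
  next
    fix x s t assume s: "\<phi> s x \<in> W'" and ts: "\<bar>t - s\<bar> \<le> T"
    \<comment> \<open>The sign \<open>e\<close> treats both time directions at once.\<close>
    define e :: real where "e = (if s \<le> t then 1 else - 1)"
    define \<sigma> where "\<sigma> u = \<phi> (s + e * u) x" for u
    have vel: "has_velocity \<A> (\<lambda>s. \<phi> s x) u UNIV (\<lambda>c. - (h (\<phi> u x) *\<^sub>R gradient \<A> ip f (\<phi> u x) c))" for u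
      using flow unfolding is_flow_def by blast
    have start: "norm (snd c (\<sigma> 0) - snd c p) < exp (- (L * \<bar>T\<bar>)) * r"
      using s by (simp add: \<sigma>_def W'_def dist_norm norm_minus_commute)
    have "T \<ge> 0"
      using ts by linarith
    have "\<sigma> \<bar>t - s\<bar> \<in> fst c \<inter> snd c -` ball (snd c p) r"
    proof (rule curve_stays_in_chart_ball[OF \<A> c(1) r(2,1) r\<^sub>0(2), where T = T])
      fix u
      have "isCont (\<lambda>s. \<phi> s x) (s + e * u)"
        using vel by (simp add: has_velocity_def)
      moreover have "isCont (\<lambda>u. s + e * u) u"
        by simp
      ultimately show "isCont \<sigma> u"
        unfolding \<sigma>_def by (rule isCont_o2[rotated])
      assume "\<sigma> u \<in> fst c \<inter> snd c -` ball (snd c p) r"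
      then have u: "\<sigma> u \<in> fst c" "snd c (\<sigma> u) \<in> ball (snd c p) r\<^sub>0"
        using r(3) by auto
      have "(snd c \<circ> (\<lambda>s. \<phi> s x) has_vector_derivative
          - (h (\<sigma> u) *\<^sub>R gradient \<A> ip f (\<sigma> u) c)) (at (s + e * u))"
        using vel[of "s + e * u"] c(1) u(1) unfolding has_velocity_def \<sigma>_def by blast
      moreover have "((\<lambda>u. s + e * u) has_vector_derivative e) (at u)"
        by (auto intro!: derivative_eq_intros)
      ultimately have "((snd c \<circ> (\<lambda>s. \<phi> s x)) \<circ> (\<lambda>u. s + e * u) has_vector_derivative
          e *\<^sub>R - (h (\<sigma> u) *\<^sub>R gradient \<A> ip f (\<sigma> u) c)) (at u)"
        by (intro vector_diff_chain_at)
      moreover have "(snd c \<circ> (\<lambda>s. \<phi> s x)) \<circ> (\<lambda>u. s + e * u) = snd c \<circ> \<sigma>"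
        by (auto simp: \<sigma>_def)
      ultimately have "(snd c \<circ> \<sigma> has_vector_derivative
          e *\<^sub>R - (h (\<sigma> u) *\<^sub>R gradient \<A> ip f (\<sigma> u) c)) (at u)"
        by (simp only:)
      moreover have "norm (e *\<^sub>R - (h (\<sigma> u) *\<^sub>R gradient \<A> ip f (\<sigma> u) c))
          \<le> 1 * norm (gradient \<A> ip f (\<sigma> u) c)"
        using mult_right_mono[OF h[of "\<sigma> u"], of "norm (gradient \<A> ip f (\<sigma> u) c)"]
        by (auto simp: e_def)
      then have "norm (e *\<^sub>R - (h (\<sigma> u) *\<^sub>R gradient \<A> ip f (\<sigma> u) c))
          \<le> L * norm (snd c (\<sigma> u) - snd c p)"
        using r\<^sub>0(4)[OF u] by linarith
      ultimately show "\<exists>w. (snd c \<circ> \<sigma> has_vector_derivative w) (at u) \<and>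
          norm w \<le> L * norm (snd c (\<sigma> u) - snd c p)"
        by blast
    next
      have "exp (L * T) * norm (snd c (\<sigma> 0) - snd c p) < exp (L * T) * (exp (- (L * \<bar>T\<bar>)) * r)"
        using start by simp
      also have "\<dots> = r"
        using \<open>T \<ge> 0\<close> by (simp add: exp_minus)
      finally show "exp (L * T) * norm (snd c (\<sigma> 0) - snd c p) < r" .
      have "exp (- (L * \<bar>T\<bar>)) * r \<le> 1 * r"
        using r(1) r\<^sub>0(2) by (intro mult_right_mono) auto
      then show "\<sigma> 0 \<in> fst c \<inter> snd c -` ball (snd c p) r"
        using s by (auto simp: \<sigma>_def W'_def)
    qed (use ts in auto)
    moreover have "\<sigma> \<bar>t - s\<bar> = \<phi> t x"
      by (auto simp: \<sigma>_def e_def)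
    ultimately obtain y where "y \<in> fst c \<inter> W" "snd c (\<phi> t x) = snd c y" "\<phi> t x \<in> fst c"
      using r(4) by auto
    then show "\<phi> t x \<in> W"
      using chart_inv_chart[OF \<A> c(1)] by (metis IntE)
  qed
qed

text \<open>
  Stability within every neighbourhood of the critical point replaces the uniqueness
  theorem for integral curves here.
\<close>
lemma flow_fixes_critical_point:
  fixes \<A> :: "('m::t2_space, 'e::{real_inner,banach}) chart set"
  assumes \<A>: "C11_atlas \<A>" and ip: "riemannian_metric_C01 \<A> ip" and f: "C11_function \<A> f"
    and flow: "is_flow \<A> (\<lambda>m c. - (h m *\<^sub>R gradient \<A> ip f m c)) \<phi>"
    and h: "\<And>m. \<bar>h m\<bar> \<le> 1"
    and crit: "critical_point \<A> ip f (\<phi> s x)"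
  shows "\<phi> t x = \<phi> s x"
proof (rule ccontr)
  assume "\<phi> t x \<noteq> \<phi> s x"
  then obtain W where W: "open W" "\<phi> s x \<in> W" "\<phi> t x \<notin> W"
    by (metis t1_space)
  obtain W' where "\<phi> s x \<in> W'"
    "\<And>y s' t'. \<phi> s' y \<in> W' \<Longrightarrow> \<bar>t' - s'\<bar> \<le> \<bar>t - s\<bar> \<Longrightarrow> \<phi> t' y \<in> W"
    using flow_stable_near_critical_point[OF \<A> ip f flow h crit W(1,2)] by metis
  then show False
    using W(3) by blast
qed

section \<open>Descent along the flow\<close>

lemma derivative_along_gradient_flow:
  fixes \<A> :: "('m::t2_space, 'e::{real_inner,banach}) chart set"
  assumes \<A>: "C11_atlas \<A>" and ip: "riemannian_metric_C01 \<A> ip" and f: "C11_function \<A> f"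
    and flow: "is_flow \<A> (\<lambda>m c. - (h m *\<^sub>R gradient \<A> ip f m c)) \<phi>"
  shows "((\<lambda>t. f (\<phi> t x)) has_real_derivative
    - (h (\<phi> t x) * (tnorm ip (\<phi> t x) (gradient \<A> ip f (\<phi> t x)))\<^sup>2)) (at t)"
proof -
  let ?m = "\<phi> t x" and ?X = "gradient \<A> ip f (\<phi> t x)"
  obtain c where c: "c \<in> \<A>" "?m \<in> fst c"
    using chart_at[OF \<A>] .
  obtain f' where f': "\<And>q. q \<in> snd c ` fst c \<Longrightarrow>
      (f \<circ> chart_inv c has_derivative blinfun_apply (f' q)) (at q)"
    using C11_function_derivative[OF f c(1)] by metis
  let ?D = "f' (snd c ?m)"
  have vel: "has_velocity \<A> (\<lambda>s. \<phi> s x) t UNIV (\<lambda>c. - (h ?m *\<^sub>R ?X c))"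
    using flow unfolding is_flow_def by blast
  note X = gradient_represents_differential(1)[OF \<A> ip f, of ?m]
  have "?D (?X c) = ip ?m ?X ?X"
    using gradient_represents_differential(2)[OF \<A> ip f X] differential_in_chart[OF \<A> f c X]
      frechet_derivative_at[OF f'] c(2) by (metis imageI)
  also have "\<dots> = (tnorm ip ?m ?X)\<^sup>2"
    using ip_self_nonneg(1)[OF \<A> ip X] by (simp add: tnorm_def)
  finally have D: "?D (- (h ?m *\<^sub>R ?X c)) = - (h ?m * (tnorm ip ?m ?X)\<^sup>2)"
    by (simp add: blinfun.bilinear_simps)
  have "(snd c \<circ> (\<lambda>s. \<phi> s x) has_derivative (\<lambda>s. s *\<^sub>R (- (h ?m *\<^sub>R ?X c)))) (at t)"
    using vel c unfolding has_velocity_def has_vector_derivative_def by blast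
  moreover have "(f \<circ> chart_inv c has_derivative blinfun_apply ?D) (at ((snd c \<circ> (\<lambda>s. \<phi> s x)) t))"
    using f' c(2) by simp
  ultimately have "((f \<circ> chart_inv c) \<circ> (snd c \<circ> (\<lambda>s. \<phi> s x)) has_derivative
      blinfun_apply ?D \<circ> (\<lambda>s. s *\<^sub>R (- (h ?m *\<^sub>R ?X c)))) (at t)"
    by (rule diff_chain_at)
  then have deriv: "((f \<circ> chart_inv c) \<circ> (snd c \<circ> (\<lambda>s. \<phi> s x)) has_real_derivative
      - (h ?m * (tnorm ip ?m ?X)\<^sup>2)) (at t)"
    by (rule has_derivative_imp_has_field_derivative)
      (use D in \<open>simp add: blinfun.scaleR_right del: scaleR_minus_right\<close>)
  have "eventually (\<lambda>s. \<phi> s x \<in> fst c) (nhds t)"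
    using vel c(2) chart_homeomorphism(1)[OF \<A> c(1)]
    unfolding has_velocity_def continuous_at_open eventually_nhds by blast
  then have "eventually (\<lambda>s. ((f \<circ> chart_inv c) \<circ> (snd c \<circ> (\<lambda>s. \<phi> s x))) s = f (\<phi> s x)) (nhds t)"
    by (rule eventually_mono) (simp add: chart_inv_chart[OF \<A> c(1)])
  from DERIV_cong_ev[OF refl this refl] deriv show ?thesis
    by (rule iffD1)
qed

lemma critical_point_if_tnorm_gradient_zero:
  fixes \<A> :: "('m::t2_space, 'e::{real_inner,banach}) chart set"
  assumes "C11_atlas \<A>" "riemannian_metric_C01 \<A> ip" "C11_function \<A> f"
    and "tnorm ip m (gradient \<A> ip f m) = 0"
  shows "critical_point \<A> ip f m"
  using ip_self_nonneg(2)[OF assms(1,2) gradient_represents_differential(1)[OF assms(1-3)]] assms(4)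
  by (simp add: critical_point_def tnorm_def)

theorem proposition9p1:
  fixes \<A> :: "('m::t2_space, 'e::{real_inner,banach}) chart set"
    and ip :: "'m \<Rightarrow> ('m, 'e) tvec \<Rightarrow> ('m, 'e) tvec \<Rightarrow> real"
    and f h :: "'m \<Rightarrow> real"
    and g :: "real \<Rightarrow> real"
    and V :: "'m \<Rightarrow> ('m, 'e) tvec"
    and \<phi> :: "real \<Rightarrow> 'm \<Rightarrow> 'm"
    and \<tau> :: real
  assumes "separable_space (euclidean :: 'e topology)"
    and "C11_atlas \<A>"
    and "riemannian_metric_C01 \<A> ip"
    and "connected (UNIV :: 'm set)"
    and "riemannian_complete \<A> ip"
    and "C11_function \<A> f"
    and "smooth_real g"
    and "mono g"
    and "\<And>x. x \<le> 1 \<Longrightarrow> g x = 1"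
    and "\<And>x. 1 \<le> x \<Longrightarrow> x \<le> 2 \<Longrightarrow> g x \<le> x"
    and "\<And>x. 2 \<le> x \<Longrightarrow> g x = x"
    and "\<And>m. h m = 1 / g (tnorm ip m (gradient \<A> ip f m))"
    and "\<And>m. V m = (\<lambda>c. - (h m *\<^sub>R gradient \<A> ip f m c))"
    and "is_flow \<A> V \<phi>"
    and "\<tau> > 0"
    and "condition_C \<A> ip f"
  shows "condition_D f (\<phi> \<tau>)"
proof -
  note \<A> = assms(2) and ip = assms(3) and f = assms(6) and C = assms(16)
  have V: "V = (\<lambda>m c. - (h m *\<^sub>R gradient \<A> ip f m c))"
    using assms(13) by blast
  then have flow: "is_flow \<A> (\<lambda>m c. - (h m *\<^sub>R gradient \<A> ip f m c)) \<phi>"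
    using assms(14) by simp
  have \<phi>0: "\<phi> 0 x = x" for x
    using flow by (simp add: is_flow_def)
  define N where "N m = tnorm ip m (gradient \<A> ip f m)" for m
  define rate where "rate m = h m * (N m)\<^sup>2" for m
  have N_nonneg: "N m \<ge> 0" for m
    using ip_self_nonneg(1)[OF \<A> ip gradient_represents_differential(1)[OF \<A> ip f]]
    by (simp add: N_def tnorm_def)
  have g_ge: "g x \<ge> 1" for x
    using assms(9)[of "min x 1"] monoD[OF assms(8), of "min x 1" x] by simp
  have h_def: "h m = 1 / g (N m)" for m
    using assms(12) by (simp add: N_def)
  have h: "0 < h m" "\<bar>h m\<bar> \<le> 1" for m
    using g_ge[of "N m"] by (auto simp: h_def field_simps)
  have rate_nonneg: "rate m \<ge> 0" for m
    using h(1)[of m] by (simp add: rate_def)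
  \<comment> \<open>Beyond norm \<open>1\<close> the rate is at least the norm, because \<open>g x \<le> x\<close> there.\<close>
  have rate_small: "(N m)\<^sup>2 = rate m" if "rate m < 1" for m
  proof (cases "N m \<le> 1")
    case True
    then show ?thesis
      using assms(9) by (simp add: rate_def h_def)
  next
    case False
    then have "g (N m) \<le> N m"
      using assms(10,11) by (cases "N m \<le> 2") auto
    then have "N m * g (N m) \<le> (N m)\<^sup>2"
      using N_nonneg by (simp add: power2_eq_square mult_left_mono)
    then have "N m \<le> rate m"
      using g_ge[of "N m"] by (simp add: rate_def h_def field_simps)
    then show ?thesis
      using that False by simp
  qed
  have deriv: "((\<lambda>t. f (\<phi> t x)) has_real_derivative - rate (\<phi> t x)) (at t)" for t x
    using derivative_along_gradient_flow[OF \<A> ip f flow] by (simp add: rate_def N_def)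
  have mvt: "\<exists>t>0. t < s \<and> f x - f (\<phi> s x) = s * rate (\<phi> t x)" if "s > 0" for s x
  proof -
    obtain t where "0 < t" "t < s" "f (\<phi> s x) - f (\<phi> 0 x) = (s - 0) * - rate (\<phi> t x)"
      using MVT2[of 0 s "\<lambda>t. f (\<phi> t x)" "\<lambda>t. - rate (\<phi> t x)", OF \<open>s > 0\<close> deriv] by blast
    then show ?thesis
      using \<phi>0 by (intro exI[of _ t]) auto
  qed
  have antimono: "f (\<phi> b x) \<le> f (\<phi> a x)" if "a \<le> b" for a b x
    using DERIV_nonpos_imp_nonincreasing[OF that, of "\<lambda>t. f (\<phi> t x)"] deriv rate_nonneg
    by (metis neg_le_0_iff_le)
  note fixed = flow_fixes_critical_point[OF \<A> ip f flow h(2)]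
  have "f (\<phi> \<tau> x) < f x" if "\<phi> \<tau> x \<noteq> x" for x
  proof (rule ccontr)
    assume "\<not> f (\<phi> \<tau> x) < f x"
    moreover obtain t where "f x - f (\<phi> \<tau> x) = \<tau> * rate (\<phi> t x)"
      using mvt[OF assms(15)] by blast
    ultimately have "rate (\<phi> t x) = 0"
      using assms(15) rate_nonneg[of "\<phi> t x"] zero_less_mult_iff[of \<tau> "rate (\<phi> t x)"] by linarith
    then have "N (\<phi> t x) = 0"
      using rate_small[of "\<phi> t x"] by simp
    then have "critical_point \<A> ip f (\<phi> t x)"
      unfolding N_def by (rule critical_point_if_tnorm_gradient_zero[OF \<A> ip f])
    then have "\<phi> \<tau> x = \<phi> 0 x"
      using fixed by metis
    then show False
      using that \<phi>0 by simp
  qed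
  moreover have "\<exists>x\<in>closure S. \<phi> \<tau> x = x"
    if bounded: "bounded (f ` S)"
      and small: "\<not> bounded_away_from_zero_on S (\<lambda>y. f y - f (\<phi> \<tau> y))" for S
  proof -
    \<comment> \<open>The bound on the decrease keeps \<open>f\<close> bounded on \<open>A\<close>; over the full time \<open>\<tau>\<close> the decrease may
      be unbounded on \<open>S\<close>.\<close>
    define A where "A = {\<phi> t y | t y. y \<in> S \<and> 0 \<le> t \<and> t \<le> \<tau> \<and> f y - f (\<phi> t y) \<le> 1}"
    obtain B where B: "\<And>y. y \<in> S \<Longrightarrow> \<bar>f y\<bar> \<le> B"
      using bounded by (auto simp: bounded_iff)
    have "\<bar>f z\<bar> \<le> B + 1" if "z \<in> A" for z
    proof -
      obtain t y where "y \<in> S" "0 \<le> t" "z = \<phi> t y" "f y - f z \<le> 1"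
        using \<open>z \<in> A\<close> unfolding A_def by blast
      then show ?thesis
        using antimono[of 0 t y] B[of y] \<phi>0[of y] by auto
    qed
    then have "bounded (f ` A)"
      by (auto simp: bounded_iff)
    moreover have "\<not> bounded_away_from_zero_on A (\<lambda>m. tnorm ip m (gradient \<A> ip f m))"
    proof
      assume "bounded_away_from_zero_on A (\<lambda>m. tnorm ip m (gradient \<A> ip f m))"
      then obtain \<epsilon> where \<epsilon>: "\<epsilon> > 0" "\<And>z. z \<in> A \<Longrightarrow> \<epsilon> \<le> N z"
        using N_nonneg unfolding bounded_away_from_zero_on_def N_def by fastforce
      \<comment> \<open>The outer \<open>1\<close> puts the intermediate point into \<open>A\<close>, the inner one makes its rate less
        than \<open>1\<close>, so that \<open>rate_small\<close> applies.\<close>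
      define \<delta> where "\<delta> = min 1 (\<tau> * min 1 (\<epsilon>\<^sup>2))"
      have "\<delta> > 0"
        using \<epsilon>(1) assms(15) by (simp add: \<delta>_def)
      then obtain y where y: "y \<in> S" "\<bar>f y - f (\<phi> \<tau> y)\<bar> < \<delta>"
        using small unfolding bounded_away_from_zero_on_def by (meson not_le)
      obtain t where t: "0 < t" "t < \<tau>" "f y - f (\<phi> \<tau> y) = \<tau> * rate (\<phi> t y)"
        using mvt[OF assms(15)] by blast
      have "\<tau> * rate (\<phi> t y) < \<tau> * min 1 (\<epsilon>\<^sup>2)"
        using y(2) t(3) unfolding \<delta>_def by linarith
      then have rate: "rate (\<phi> t y) < 1" "rate (\<phi> t y) < \<epsilon>\<^sup>2"
        using assms(15) by auto
      have "f y - f (\<phi> t y) \<le> 1"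
        using y(2) antimono[of t \<tau> y] t(2) unfolding \<delta>_def by linarith
      then have "\<phi> t y \<in> A"
        using y(1) t unfolding A_def by (auto intro!: exI[of _ t] exI[of _ y])
      then have "\<epsilon>\<^sup>2 \<le> (N (\<phi> t y))\<^sup>2"
        using \<epsilon> by (intro power_mono) auto
      then show False
        using rate rate_small by simp
    qed
    ultimately obtain p where p: "p \<in> closure A" "critical_point \<A> ip f p"
      using C unfolding condition_C_def by blast
    have "\<phi> \<tau> p = p"
      using fixed[of 0 p \<tau>] p(2) \<phi>0 by simp
    moreover have "p \<in> closure S"
    proof (rule ccontr)
      assume "p \<notin> closure S"
      then obtain W' where W': "open W'" "p \<in> W'"
        "\<And>x s t. \<phi> s x \<in> W' \<Longrightarrow> \<bar>t - s\<bar> \<le> \<tau> \<Longrightarrow> \<phi> t x \<in> - closure S"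
        using flow_stable_near_critical_point[OF \<A> ip f flow h(2) p(2), of "- closure S"]
        by (metis ComplI closed_closure open_Compl)
      then obtain z where "z \<in> A" "z \<in> W'"
        using p(1) closure_iff_nhds_not_empty by blast
      then obtain t y where "y \<in> S" "0 \<le> t" "t \<le> \<tau>" "\<phi> t y \<in> W'"
        unfolding A_def by blast
      then have "\<phi> 0 y \<in> - closure S"
        using W'(3)[of t y 0] by simp
      then show False
        using \<open>y \<in> S\<close> \<phi>0 closure_subset by auto
    qed
    ultimately show ?thesis
      by blast
  qed
  ultimately show ?thesis
    unfolding condition_D_def by blast
qed

end
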